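(* Consider a stochastic $K$-armed bandit with rewards in $[0,1]$ and horizon $T$, and run (coupled) RandUCB with sampling random variable $Z$. Let $c_1 := 1+\sqrt{\ln(KT^2)}$ and $c_3 := 2K\ln\left(1+\frac{T}{K}\right)$. For any $c_2>c_1$, the regret $R(T)$ of RandUCB is bounded by $$(c_1+c_2)\left(1+\frac{2}{\mathbf{P}(Z>c_1)-\mathbf{P}(|Z|>c_2)}\right)\sqrt{c_3T}+T\,\mathbf{P}(|Z|>c_2)+K+1 .$$
   Context: Stochastic multi-armed bandit: there are $K$ arms; arm $i$ has a reward distribution supported on $[0,1]$ with mean $\mu_i$. In each round $t=1,\dots,T$ the learner pulls an arm $i_t$ (based on the past and its own randomness) and receives a reward drawn from the distribution of arm $i_t$. Without loss of generality arm $1$ is optimal, $\mu_1=\max_i\mu_i$. The regret is $R(T)=\sum_{t=1}^T\mathbf{E}[\mu_1-\mu_{i_t}]$. RandUCB (coupled version) for this problem: let $Z$ be a given real-valued random variable and $Z_1,Z_2,\dots$ i.i.d. copies of $Z$. The algorithm first pulls each arm once. In each subsequent round $t>K$ it pulls $$i_t=\arg\max_i\left\{\hat\mu_i(t)+Z_t\sqrt{\tfrac{1}{s_i(t)}}\right\},$$ where $s_i(t)$ is the number of pulls of arm $i$ made so far, and $\hat\mu_i(t)$ is the average of the rewards received from arm $i$ so far. The same $Z_t$ is used for all arms.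
   Formalization: The bound is proved under the added assumption P(|Z|>c_2) < P(Z>c_1), and for T at least 1; without that assumption the fraction is undefined when the difference is zero, and when it is negative the bound can be negative and hence false. *)

theory Defs
  imports "HOL-Probability.Probability"
begin

definition arm_mean :: "(nat \<Rightarrow> real measure) \<Rightarrow> nat \<Rightarrow> real" where
  "arm_mean \<nu> i = (\<integral>x. x \<partial>\<nu> i)"

definition best_mean :: "nat \<Rightarrow> (nat \<Rightarrow> real measure) \<Rightarrow> real" where
  "best_mean K \<nu> = (MAX i\<in>{1..K}. arm_mean \<nu> i)"

(* arm t \<omega> is the arm pulled in round t; rounds are numbered from 1. *)

definition regret ::
  "'a measure \<Rightarrow> nat \<Rightarrow> (nat \<Rightarrow> real measure) \<Rightarrow> (nat \<Rightarrow> 'a \<Rightarrow> nat) \<Rightarrow> nat \<Rightarrow> real" where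
  "regret M K \<nu> arm T = (\<Sum>t=1..T. \<integral>\<omega>. (best_mean K \<nu> - arm_mean \<nu> (arm t \<omega>)) \<partial>M)"

(* Both statistics at round t refer to the rounds strictly before t. *)

definition num_pulls :: "(nat \<Rightarrow> 'a \<Rightarrow> nat) \<Rightarrow> nat \<Rightarrow> nat \<Rightarrow> 'a \<Rightarrow> nat" where
  "num_pulls arm i t \<omega> = card {u \<in> {1..<t}. arm u \<omega> = i}"

definition emp_mean ::
  "(nat \<Rightarrow> 'a \<Rightarrow> nat) \<Rightarrow> (nat \<Rightarrow> 'a \<Rightarrow> real) \<Rightarrow> nat \<Rightarrow> nat \<Rightarrow> 'a \<Rightarrow> real" where
  "emp_mean arm rew i t \<omega> =
     (\<Sum>u | u \<in> {1..<t} \<and> arm u \<omega> = i. rew u \<omega>) / real (num_pulls arm i t \<omega>)"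

locale stochastic_bandit =
  fixes K :: nat and \<nu> :: "nat \<Rightarrow> real measure"
  assumes arms_nonempty: "1 \<le> K"
    and prob_space_arm: "i \<in> {1..K} \<Longrightarrow> prob_space (\<nu> i)"
    and sets_arm: "i \<in> {1..K} \<Longrightarrow> sets (\<nu> i) = sets borel"
    and support_arm: "i \<in> {1..K} \<Longrightarrow> AE x in \<nu> i. x \<in> {0..1}"

(* Interaction of a learner with the bandit during rounds 1..T.
   F t is the information available after round t, and G t that available in round t once the
   arm has been chosen but before the reward is revealed.  Both may contain additional
   randomness of the learner.  The last assumption says that, conditionally on G t, the reward
   of round t has the distribution of the pulled arm. *)

locale bandit_run = stochastic_bandit K \<nu> + prob_space M
  for K :: nat and \<nu> :: "nat \<Rightarrow> real measure" and M :: "'a measure" +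
  fixes T :: nat
    and F G :: "nat \<Rightarrow> 'a measure"
    and arm :: "nat \<Rightarrow> 'a \<Rightarrow> nat"
    and rew :: "nat \<Rightarrow> 'a \<Rightarrow> real"
  assumes subalgebra_F: "t \<le> T \<Longrightarrow> subalgebra M (F t)"
    and subalgebra_GF: "t \<in> {1..T} \<Longrightarrow> subalgebra (G t) (F (t - 1))"
    and subalgebra_FG: "t \<in> {1..T} \<Longrightarrow> subalgebra (F t) (G t)"
    and arm_measurable: "t \<in> {1..T} \<Longrightarrow> arm t \<in> measurable (G t) (count_space {1..K})"
    and rew_measurable: "t \<in> {1..T} \<Longrightarrow> rew t \<in> borel_measurable (F t)"
    and rew_cond_law: "t \<in> {1..T} \<Longrightarrow> B \<in> sets borel \<Longrightarrow>
      AE \<omega> in M. real_cond_exp M (G t) (\<lambda>\<omega>. indicator B (rew t \<omega>)) \<omega> = measure (\<nu> (arm t \<omega>)) B"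

(* Coupled RandUCB.  Zs t is the copy of Z drawn in round t: it is independent of the whole past
   F (t - 1), which contains the earlier copies, so the Zs t are i.i.d.  In the first K rounds
   only arms not pulled before are chosen, so each arm is pulled once, in an arbitrary order.
   Ties in the argmax may be broken arbitrarily, using any information in G t. *)

locale randucb = bandit_run K \<nu> M T F G arm rew + Z: prob_space N
  for K :: nat and \<nu> :: "nat \<Rightarrow> real measure" and M :: "'a measure" and T :: nat
    and F G :: "nat \<Rightarrow> 'a measure" and arm :: "nat \<Rightarrow> 'a \<Rightarrow> nat" and rew :: "nat \<Rightarrow> 'a \<Rightarrow> real"
    and N :: "'b measure" +
  fixes Z :: "'b \<Rightarrow> real" and Zs :: "nat \<Rightarrow> 'a \<Rightarrow> real"
  assumes Z_measurable: "Z \<in> borel_measurable N"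
    and Zs_measurable: "t \<in> {1..T} \<Longrightarrow> Zs t \<in> borel_measurable (G t)"
    and Zs_distr: "t \<in> {1..T} \<Longrightarrow> distr M borel (Zs t) = distr N borel Z"
    and Zs_indep: "t \<in> {1..T} \<Longrightarrow>
      indep_set (sets (F (t - 1))) (sets (vimage_algebra (space M) (Zs t) borel))"
    and initial_pulls: "t \<in> {1..T} \<Longrightarrow> t \<le> K \<Longrightarrow> \<omega> \<in> space M \<Longrightarrow>
      num_pulls arm (arm t \<omega>) t \<omega> = 0"
    and argmax_pulls: "t \<in> {1..T} \<Longrightarrow> K < t \<Longrightarrow> \<omega> \<in> space M \<Longrightarrow>
      is_arg_max (\<lambda>i. emp_mean arm rew i t \<omega> + Zs t \<omega> * sqrt (1 / real (num_pulls arm i t \<omega>)))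
        (\<lambda>i. i \<in> {1..K}) (arm t \<omega>)"

end

theory Submission
  imports Defs
begin

text \<open>
  Write \<open>r\<^sub>i = sqrt (1 / s\<^sub>i)\<close> and \<open>w = c1 + c2\<close>, and let \<open>p\<close> be the denominator in the bound.  By Hoeffding's
  lemma \<open>exp (l * S\<^sub>i - l\<^sup>2 * s\<^sub>i / 8)\<close> is a supermartingale, \<open>S\<^sub>i\<close> being the centred reward sum of arm \<open>i\<close>.
  Markov's inequality for each possible value of \<open>s\<^sub>i\<close> and a union bound show that in every round all
  empirical means are within \<open>c1 * r\<^sub>i\<close> of the true ones, except with probability \<open>1 / T\<close>.

  In a round where this holds, call an arm undersampled if its gap is at most \<open>w * r\<^sub>i\<close>, and let \<open>j\<close> be
  the undersampled arm of least \<open>r\<^sub>j\<close>.  If \<open>\<bar>Z\<bar> \<le> c2\<close>, comparing the pulled arm \<open>i\<close> with \<open>j\<close> bounds its gap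
  by \<open>w * (2 * r\<^sub>j + r\<^sub>i)\<close>.  If \<open>c1 < Z \<le> c2\<close>, the index of the optimal arm exceeds those of all sufficiently
  sampled arms, so \<open>i\<close> is undersampled and \<open>r\<^sub>j \<le> r\<^sub>i\<close>.  This event has probability at least \<open>p\<close> and is
  independent of the past, whence \<open>E r\<^sub>j \<le> E r\<^sub>i / p\<close>.  The sum of the \<open>r\<^sub>i\<close> over the rounds is at most
  \<open>sqrt (c3 * T)\<close> by Cauchy-Schwarz, harmonic sums and Jensen's inequality.
\<close>

subsection \<open>Counting pulls\<close>

lemma num_pulls_Suc:
  assumes "1 \<le> t"
  shows "num_pulls arm i (Suc t) \<omega> = num_pulls arm i t \<omega> + (if arm t \<omega> = i then 1 else 0)"
proof -
  have "{u \<in> {1..<Suc t}. arm u \<omega> = i} =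
      (if arm t \<omega> = i then insert t {u \<in> {1..<t}. arm u \<omega> = i} else {u \<in> {1..<t}. arm u \<omega> = i})"
    using assms by (auto simp: less_Suc_eq)
  then show ?thesis
    by (simp add: num_pulls_def)
qed

lemma num_pulls_le: "num_pulls arm i t \<omega> \<le> t - 1"
proof -
  have "num_pulls arm i t \<omega> \<le> card {1..<t}"
    unfolding num_pulls_def by (intro card_mono) auto
  then show ?thesis by simp
qed

lemma sum_num_pulls:
  assumes "\<And>t. t \<in> {1..n} \<Longrightarrow> arm t \<omega> \<in> {1..K}"
  shows "(\<Sum>i=1..K. num_pulls arm i (Suc n) \<omega>) = n"
  using assms
proof (induction n)
  case 0
  then show ?case by (simp add: num_pulls_def)
next
  case (Suc n)
  have "arm (Suc n) \<omega> \<in> {1..K}"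
    using Suc.prems by simp
  moreover have "(\<Sum>i=1..K. num_pulls arm i (Suc n) \<omega>) = n"
    using Suc by simp
  ultimately show ?case
    by (simp add: num_pulls_Suc[of "Suc n"] sum.distrib sum.delta)
qed

lemma inverse_le_2_ln_diff:
  "1 / real n \<le> 2 * ln (real (Suc n)) - 2 * ln (real n)"
proof (cases "n = 0")
  case False
  then have n: "1 \<le> n" by simp
  have "ln (real n / real (Suc n)) \<le> real n / real (Suc n) - 1"
    using n by (intro ln_le_minus_one) simp
  then have "1 / real (Suc n) \<le> ln (real (Suc n)) - ln (real n)"
    using n by (simp add: ln_div field_simps)
  moreover have "1 / real n \<le> 2 * (1 / real (Suc n))"
    using n by (simp add: field_simps)
  ultimately show ?thesis by linarith
qed simp

text \<open>Division by zero makes the first pull of an arm contribute \<open>0\<close>, and \<open>ln 0 = 0\<close> is the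
  matching value on the right.\<close>

lemma sum_inverse_num_pulls_le_ln:
  assumes "\<And>t. t \<in> {1..n} \<Longrightarrow> arm t \<omega> \<in> {1..K}"
  shows "(\<Sum>t=1..n. 1 / real (num_pulls arm (arm t \<omega>) t \<omega>))
    \<le> (\<Sum>i=1..K. 2 * ln (real (num_pulls arm i (Suc n) \<omega>)))"
  using assms
proof (induction n)
  case 0
  then show ?case by (simp add: num_pulls_def)
next
  case (Suc n)
  let ?a = "arm (Suc n) \<omega>"
  let ?s = "\<lambda>i. num_pulls arm i (Suc n) \<omega>"
  have a: "?a \<in> {1..K}"
    using Suc.prems by simp
  have "(\<Sum>t=1..Suc n. 1 / real (num_pulls arm (arm t \<omega>) t \<omega>))
      \<le> (\<Sum>i=1..K. 2 * ln (real (?s i))) + (2 * ln (real (Suc (?s ?a))) - 2 * ln (real (?s ?a)))"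
    using Suc inverse_le_2_ln_diff[of "?s ?a"] by simp
  also have "\<dots> = (\<Sum>i=1..K. 2 * ln (real (?s i)) +
      (if i = ?a then 2 * ln (real (Suc (?s ?a))) - 2 * ln (real (?s ?a)) else 0))"
    using a by (simp add: sum.distrib sum.delta)
  also have "\<dots> = (\<Sum>i=1..K. 2 * ln (real (num_pulls arm i (Suc (Suc n)) \<omega>)))"
    by (intro sum.cong) (auto simp: num_pulls_Suc[of "Suc n"])
  finally show ?case .
qed

lemma sum_inverse_num_pulls_le:
  assumes K: "1 \<le> K" and arm: "\<And>t. t \<in> {1..n} \<Longrightarrow> arm t \<omega> \<in> {1..K}"
  shows "(\<Sum>t=1..n. 1 / real (num_pulls arm (arm t \<omega>) t \<omega>))
    \<le> 2 * real K * ln (1 + real n / real K)"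
proof -
  define a where "a = 1 + real n / real K"
  have a: "0 < a" using K by (simp add: a_def add_pos_nonneg)
  let ?s = "\<lambda>i. real (num_pulls arm i (Suc n) \<omega>)"
  have sum_s: "(\<Sum>i=1..K. ?s i) = real n"
    using sum_num_pulls[of n arm \<omega> K] arm by (metis (no_types) of_nat_sum)
  \<comment> \<open>Jensen's inequality, through the tangent of \<open>ln\<close> at \<open>a\<close>\<close>
  have "ln (?s i) \<le> ln a + (1 + ?s i - a) / a" for i
  proof -
    have "ln (?s i) \<le> ln (1 + ?s i)"
      by (cases "num_pulls arm i (Suc n) \<omega> = 0") auto
    also have "\<dots> = ln a + ln ((1 + ?s i) / a)"
      using a by (simp add: ln_div add_pos_nonneg)
    also have "ln ((1 + ?s i) / a) \<le> (1 + ?s i) / a - 1"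
      using a by (intro ln_le_minus_one divide_pos_pos) (auto simp: add_pos_nonneg)
    finally show ?thesis using a by (simp add: field_simps)
  qed
  then have "(\<Sum>i=1..K. 2 * ln (?s i)) \<le> (\<Sum>i=1..K. 2 * (ln a + (1 + ?s i - a) / a))"
    by (intro sum_mono mult_left_mono) auto
  also have "\<dots> = 2 * real K * ln a + 2 * (real K + (\<Sum>i=1..K. ?s i) - real K * a) / a"
    by (simp add: sum.distrib sum_subtractf sum_distrib_left[symmetric] sum_divide_distrib[symmetric]
        add_divide_distrib diff_divide_distrib algebra_simps)
  also have "\<dots> = 2 * real K * ln a"
    using K unfolding sum_s by (simp add: a_def field_simps)
  finally show ?thesis
    using sum_inverse_num_pulls_le_ln[of n arm \<omega> K] arm by (fastforce simp: a_def)
qed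

lemma sum_sqrt_inverse_num_pulls_le:
  assumes K: "1 \<le> K" and arm: "\<And>t. t \<in> {1..n} \<Longrightarrow> arm t \<omega> \<in> {1..K}"
  shows "(\<Sum>t=1..n. sqrt (1 / real (num_pulls arm (arm t \<omega>) t \<omega>)))
    \<le> sqrt (2 * real K * ln (1 + real n / real K) * real n)"
proof (rule real_le_rsqrt)
  let ?r = "\<lambda>t. 1 / real (num_pulls arm (arm t \<omega>) t \<omega>)"
  have "(\<Sum>t=1..n. sqrt (?r t) * 1)\<^sup>2 \<le> (\<Sum>t=1..n. (sqrt (?r t))\<^sup>2) * (\<Sum>t=1..n. 1\<^sup>2)"
    by (rule Cauchy_Schwarz_ineq_sum)
  also have "\<dots> = (\<Sum>t=1..n. ?r t) * real n"
    by simp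
  also have "\<dots> \<le> (2 * real K * ln (1 + real n / real K)) * real n"
    by (intro mult_right_mono sum_inverse_num_pulls_le K arm) auto
  finally show "(\<Sum>t=1..n. sqrt (?r t))\<^sup>2 \<le> 2 * real K * ln (1 + real n / real K) * real n"
    by simp
qed

subsection \<open>Concentration of the empirical means\<close>

context stochastic_bandit
begin

lemma finite_arms: "finite {1..K}" and arms_ne: "{1..K} \<noteq> {}"
  using arms_nonempty by auto

lemma interval_bounded_arm:
  assumes "i \<in> {1..K}"
  shows "interval_bounded_random_variable (\<nu> i) (\<lambda>x. x) 0 1"
proof -
  interpret prob_space "\<nu> i" by (rule prob_space_arm[OF assms])
  have [measurable_cong]: "sets (\<nu> i) = sets borel" by (rule sets_arm[OF assms])
  show ?thesis
    by unfold_locales (use support_arm[OF assms] in auto)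
qed

lemma arm_mean_bounds:
  assumes "i \<in> {1..K}"
  shows "0 \<le> arm_mean \<nu> i" "arm_mean \<nu> i \<le> 1"
proof -
  interpret interval_bounded_random_variable "\<nu> i" "\<lambda>x. x" 0 1
    by (rule interval_bounded_arm[OF assms])
  show "0 \<le> arm_mean \<nu> i"
    unfolding arm_mean_def
    by (rule integral_nonneg_AE) (rule eventually_mono[OF AE_in_interval], simp)
  show "arm_mean \<nu> i \<le> 1"
    unfolding arm_mean_def
    by (rule integral_le_const[OF integrable]) (rule eventually_mono[OF AE_in_interval], simp)
qed

lemma best_mean_ge: "i \<in> {1..K} \<Longrightarrow> arm_mean \<nu> i \<le> best_mean K \<nu>"
  unfolding best_mean_def by (intro Max_ge) auto

lemma best_mean_attained: "\<exists>a\<in>{1..K}. best_mean K \<nu> = arm_mean \<nu> a"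
proof -
  have "best_mean K \<nu> \<in> arm_mean \<nu> ` {1..K}"
    unfolding best_mean_def using arms_ne by (intro Max_in) auto
  then show ?thesis by auto
qed

lemma gap_bounds:
  assumes "i \<in> {1..K}"
  shows "0 \<le> best_mean K \<nu> - arm_mean \<nu> i" "best_mean K \<nu> - arm_mean \<nu> i \<le> 1"
proof -
  obtain a where "a \<in> {1..K}" "best_mean K \<nu> = arm_mean \<nu> a"
    using best_mean_attained by auto
  then show "0 \<le> best_mean K \<nu> - arm_mean \<nu> i" "best_mean K \<nu> - arm_mean \<nu> i \<le> 1"
    using best_mean_ge[OF assms] arm_mean_bounds[of a] arm_mean_bounds[OF assms] by auto
qed

lemma arm_mgf_le:
  assumes i: "i \<in> {1..K}"
  shows "(\<integral>\<^sup>+x. ennreal (exp (l * (x - arm_mean \<nu> i))) \<partial>\<nu> i) \<le> ennreal (exp (l\<^sup>2 / 8))"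
proof -
  interpret pos: interval_bounded_random_variable "\<nu> i" "\<lambda>x. x" 0 1
    by (rule interval_bounded_arm[OF i])
  interpret neg: interval_bounded_random_variable "\<nu> i" "\<lambda>x. - x" "-1" 0
    by unfold_locales (auto intro: eventually_mono[OF support_arm[OF i]])
  consider "l = 0" | "l > 0" | "l < 0" by linarith
  then show ?thesis
  proof cases
    case 1
    then show ?thesis by (simp add: pos.emeasure_space_1)
  next
    case 2
    then show ?thesis
      using pos.Hoeffdings_lemma_nn_integral[of l] by (simp add: arm_mean_def)
  next
    case 3
    then show ?thesis
      using neg.Hoeffdings_lemma_nn_integral[of "- l"] by (simp add: arm_mean_def algebra_simps)
  qed
qed

end

lemma num_pulls_eq_sum:
  "num_pulls arm i t \<omega> = (\<Sum>u\<in>{1..<t}. if arm u \<omega> = i then 1 else 0)"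
  unfolding num_pulls_def by (simp add: sum.If_cases Int_def)

definition reward_dev ::
  "(nat \<Rightarrow> real measure) \<Rightarrow> (nat \<Rightarrow> 'a \<Rightarrow> nat) \<Rightarrow> (nat \<Rightarrow> 'a \<Rightarrow> real) \<Rightarrow> nat \<Rightarrow> nat \<Rightarrow> 'a \<Rightarrow> real" where
  "reward_dev \<nu> arm rew i t \<omega> =
     (\<Sum>u\<in>{1..<t}. if arm u \<omega> = i then rew u \<omega> - arm_mean \<nu> i else 0)"

lemma reward_dev_Suc:
  assumes "1 \<le> t"
  shows "reward_dev \<nu> arm rew i (Suc t) \<omega> =
    reward_dev \<nu> arm rew i t \<omega> + (if arm t \<omega> = i then rew t \<omega> - arm_mean \<nu> i else 0)"
  using assms by (simp add: reward_dev_def)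

lemma emp_mean_minus_arm_mean:
  assumes "0 < num_pulls arm i t \<omega>"
  shows "emp_mean arm rew i t \<omega> - arm_mean \<nu> i =
    reward_dev \<nu> arm rew i t \<omega> / real (num_pulls arm i t \<omega>)"
proof -
  let ?U = "{u. u \<in> {1..<t} \<and> arm u \<omega> = i}"
  have "reward_dev \<nu> arm rew i t \<omega> = (\<Sum>u\<in>?U. rew u \<omega> - arm_mean \<nu> i)"
    unfolding reward_dev_def by (subst sum.If_cases) (auto simp: Int_def)
  also have "\<dots> = (\<Sum>u\<in>?U. rew u \<omega>) - real (num_pulls arm i t \<omega>) * arm_mean \<nu> i"
    by (simp add: sum_subtractf num_pulls_def)
  finally show ?thesis
    using assms by (simp add: emp_mean_def field_simps)
qed

context bandit_run
begin

lemma subalgebra_G: "t \<in> {1..T} \<Longrightarrow> subalgebra M (G t)"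
  using subalgebra_F[of t] subalgebra_FG[of t] by (auto simp: subalgebra_def)

lemma space_G: "t \<in> {1..T} \<Longrightarrow> space (G t) = space M"
  using subalgebra_G by (auto simp: subalgebra_def)

lemma subalgebra_F_mono:
  assumes "s \<le> t" "t \<le> T"
  shows "subalgebra (F t) (F s)"
  using assms
proof (induction t rule: dec_induct)
  case base
  show ?case by (simp add: subalgebra_def)
next
  case (step t)
  then have "subalgebra (F t) (F s)" by simp
  moreover have "subalgebra (G (Suc t)) (F t)" "subalgebra (F (Suc t)) (G (Suc t))"
    using subalgebra_GF[of "Suc t"] subalgebra_FG[of "Suc t"] step by auto
  ultimately show ?case by (auto simp: subalgebra_def)
qed

lemma arm_in: "t \<in> {1..T} \<Longrightarrow> \<omega> \<in> space M \<Longrightarrow> arm t \<omega> \<in> {1..K}"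
  using measurable_space[OF arm_measurable, of t \<omega>] space_G[of t] by simp

lemma arm_measurable_UNIV: "t \<in> {1..T} \<Longrightarrow> arm t \<in> measurable (G t) (count_space UNIV)"
  by (rule measurable_compose[OF arm_measurable, of t "\<lambda>x. x"]) auto

lemma indicator_arm_measurable:
  assumes "t \<in> {1..T}"
  shows "(\<lambda>\<omega>. indicator A (arm t \<omega>) :: ennreal) \<in> borel_measurable (G t)"
  by (rule measurable_compose[OF arm_measurable_UNIV[OF assms]]) simp

lemma arm_measurable_F:
  assumes "u \<in> {1..<t}" "t \<le> Suc T"
  shows "arm u \<in> measurable (F (t - 1)) (count_space UNIV)"
proof (rule measurable_from_subalg[OF subalgebra_F_mono])
  show "arm u \<in> measurable (F u) (count_space UNIV)"
    using assms by (intro measurable_from_subalg[OF subalgebra_FG] arm_measurable_UNIV) auto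
qed (use assms in auto)

lemma rew_measurable_F:
  assumes "u \<in> {1..<t}" "t \<le> Suc T"
  shows "rew u \<in> borel_measurable (F (t - 1))"
  by (rule measurable_from_subalg[OF subalgebra_F_mono rew_measurable]) (use assms in auto)

lemma num_pulls_measurable_F:
  assumes t: "t \<le> Suc T"
  shows "num_pulls arm i t \<in> measurable (F (t - 1)) (count_space UNIV)"
proof -
  note [measurable] = arm_measurable_F[OF _ t]
  show ?thesis
    unfolding num_pulls_eq_sum[abs_def] by measurable
qed

lemma reward_dev_measurable_F:
  assumes t: "t \<le> Suc T"
  shows "reward_dev \<nu> arm rew i t \<in> borel_measurable (F (t - 1))"
proof -
  note [measurable] = arm_measurable_F[OF _ t] rew_measurable_F[OF _ t]
  show ?thesis
    unfolding reward_dev_def[abs_def] by measurable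
qed

lemma nn_integral_reward:
  assumes t: "t \<in> {1..T}" and i: "i \<in> {1..K}"
    and W [measurable]: "W \<in> borel_measurable (G t)" and g [measurable]: "g \<in> borel_measurable borel"
  shows "(\<integral>\<^sup>+\<omega>. W \<omega> * indicator {i} (arm t \<omega>) * g (rew t \<omega>) \<partial>M) =
    (\<integral>\<^sup>+\<omega>. W \<omega> * indicator {i} (arm t \<omega>) \<partial>M) * (\<integral>\<^sup>+x. g x \<partial>\<nu> i)"
proof -
  interpret \<nu>: prob_space "\<nu> i" by (rule prob_space_arm[OF i])
  have sets_\<nu> [measurable_cong]: "sets (\<nu> i) = sets borel" by (rule sets_arm[OF i])
  have "finite_measure_subalgebra M (G t)"
    using subalgebra_G[OF t] by unfold_locales
  then interpret G: sigma_finite_subalgebra M "G t"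
    by (rule finite_measure_subalgebra_is_sigma_finite)
  define V where "V = (\<lambda>\<omega>. W \<omega> * indicator {i} (arm t \<omega>))"
  note [measurable] = indicator_arm_measurable[OF t]
  have V_G [measurable]: "V \<in> borel_measurable (G t)"
    unfolding V_def by measurable
  have V_M [measurable]: "V \<in> borel_measurable M"
    by (rule measurable_from_subalg[OF subalgebra_G[OF t] V_G])
  have rew_M [measurable]: "rew t \<in> borel_measurable M"
    using t by (intro measurable_from_subalg[OF subalgebra_F rew_measurable]) auto
  have "distr (density M V) borel (rew t) = scale_measure (\<integral>\<^sup>+\<omega>. V \<omega> \<partial>M) (\<nu> i)"
  proof (rule measure_eqI)
    fix B assume "B \<in> sets (distr (density M V) borel (rew t))"
    then have B [measurable]: "B \<in> sets borel" by simp
    let ?I = "\<lambda>\<omega>. indicator B (rew t \<omega>) :: real"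
    let ?c = "nn_cond_exp M (G t)"
    have "AE \<omega> in M. ?c (\<lambda>\<omega>. ennreal (?I \<omega>)) \<omega> \<le> ?c (\<lambda>_. 1) \<omega>"
      by (rule G.nn_cond_exp_mono) (auto split: split_indicator)
    moreover have "AE \<omega> in M. 1 = ?c (\<lambda>_. 1) \<omega>"
      by (rule G.nn_cond_exp_F_meas) auto
    moreover have "AE \<omega> in M. 0 = ?c (\<lambda>_. 0) \<omega>"
      by (rule G.nn_cond_exp_F_meas) auto
    moreover have "AE \<omega> in M. real_cond_exp M (G t) ?I \<omega> = measure (\<nu> (arm t \<omega>)) B"
      by (rule rew_cond_law[OF t B])
    ultimately have c: "AE \<omega> in M. ?c (\<lambda>\<omega>. ennreal (?I \<omega>)) \<omega> = ennreal (measure (\<nu> (arm t \<omega>)) B)"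
    proof eventually_elim
      case (elim \<omega>)
      have "(\<lambda>\<omega>. ennreal (- ?I \<omega>)) = (\<lambda>_. 0)"
        by (auto simp: fun_eq_iff ennreal_neg)
      then have "enn2real (?c (\<lambda>\<omega>. ennreal (?I \<omega>)) \<omega>) = measure (\<nu> (arm t \<omega>)) B"
        using elim by (simp add: real_cond_exp_def)
      moreover have "?c (\<lambda>\<omega>. ennreal (?I \<omega>)) \<omega> < \<top>"
        using elim by (metis ennreal_one_less_top order_le_less_trans)
      ultimately show ?case
        by (metis ennreal_enn2real)
    qed
    have "emeasure (distr (density M V) borel (rew t)) B =
        (\<integral>\<^sup>+\<omega>. V \<omega> * indicator (rew t -` B \<inter> space M) \<omega> \<partial>M)"
      by (simp add: emeasure_distr emeasure_density)
    also have "\<dots> = (\<integral>\<^sup>+\<omega>. V \<omega> * ennreal (?I \<omega>) \<partial>M)"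
      by (intro nn_integral_cong) (auto split: split_indicator)
    also have "\<dots> = (\<integral>\<^sup>+\<omega>. V \<omega> * ?c (\<lambda>\<omega>. ennreal (?I \<omega>)) \<omega> \<partial>M)"
      by (rule G.nn_cond_exp_intg[symmetric]) measurable
    also have "\<dots> = (\<integral>\<^sup>+\<omega>. V \<omega> * emeasure (\<nu> i) B \<partial>M)"
      by (rule nn_integral_cong_AE, rule eventually_mono[OF c])
        (auto simp: V_def \<nu>.emeasure_eq_measure split: split_indicator)
    also have "\<dots> = emeasure (scale_measure (\<integral>\<^sup>+\<omega>. V \<omega> \<partial>M) (\<nu> i)) B"
      by (simp add: nn_integral_multc)
    finally show "emeasure (distr (density M V) borel (rew t)) B =
        emeasure (scale_measure (\<integral>\<^sup>+\<omega>. V \<omega> \<partial>M) (\<nu> i)) B" .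
  qed (simp add: sets_\<nu>)
  then have "(\<integral>\<^sup>+x. g x \<partial>distr (density M V) borel (rew t)) =
      (\<integral>\<^sup>+x. g x \<partial>scale_measure (\<integral>\<^sup>+\<omega>. V \<omega> \<partial>M) (\<nu> i))" by simp
  then have "(\<integral>\<^sup>+\<omega>. V \<omega> * g (rew t \<omega>) \<partial>M) = (\<integral>\<^sup>+\<omega>. V \<omega> \<partial>M) * (\<integral>\<^sup>+x. g x \<partial>\<nu> i)"
    by (simp add: nn_integral_distr nn_integral_density nn_integral_scale_measure)
  then show ?thesis
    by (simp add: V_def)
qed

lemma reward_dev_mgf_le:
  assumes i: "i \<in> {1..K}" and t: "1 \<le> t" "t \<le> Suc T"
  shows "(\<integral>\<^sup>+\<omega>. ennreal (exp (l * reward_dev \<nu> arm rew i t \<omega> -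
    l\<^sup>2 / 8 * real (num_pulls arm i t \<omega>))) \<partial>M) \<le> 1"
  using t
proof (induction t rule: dec_induct)
  case base
  then show ?case
    by (simp add: reward_dev_def num_pulls_def emeasure_space_1)
next
  case (step t)
  interpret \<nu>: prob_space "\<nu> i" by (rule prob_space_arm[OF i])
  have [measurable_cong]: "sets (\<nu> i) = sets borel" by (rule sets_arm[OF i])
  have t: "t \<in> {1..T}" "t \<le> Suc T" using step by auto
  define X where "X = (\<lambda>\<omega>. ennreal (exp (l * reward_dev \<nu> arm rew i t \<omega> -
    l\<^sup>2 / 8 * real (num_pulls arm i t \<omega>))))"
  define g where "g = (\<lambda>x. ennreal (exp (l * (x - arm_mean \<nu> i) - l\<^sup>2 / 8)))"
  have "X \<in> borel_measurable (F (t - 1))"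
    unfolding X_def using num_pulls_measurable_F[OF t(2)] reward_dev_measurable_F[OF t(2)]
    by measurable
  then have X_G [measurable]: "X \<in> borel_measurable (G t)"
    by (rule measurable_from_subalg[OF subalgebra_GF[OF t(1)]])
  have [measurable]: "X \<in> borel_measurable M"
    by (rule measurable_from_subalg[OF subalgebra_G[OF t(1)] X_G])
  have [measurable]: "(\<lambda>\<omega>. indicator A (arm t \<omega>) :: ennreal) \<in> borel_measurable M" for A
    by (rule measurable_from_subalg[OF subalgebra_G[OF t(1)] indicator_arm_measurable[OF t(1)]])
  have [measurable]: "rew t \<in> borel_measurable M"
    using t(1) by (intro measurable_from_subalg[OF subalgebra_F rew_measurable]) auto
  have [measurable]: "g \<in> borel_measurable borel"
    unfolding g_def by measurable
  have "(\<integral>\<^sup>+x. g x \<partial>\<nu> i) =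
      (\<integral>\<^sup>+x. ennreal (exp (- (l\<^sup>2 / 8))) * ennreal (exp (l * (x - arm_mean \<nu> i))) \<partial>\<nu> i)"
    by (simp add: g_def ennreal_mult'[symmetric] exp_add[symmetric])
  also have "\<dots> \<le> ennreal (exp (- (l\<^sup>2 / 8))) * ennreal (exp (l\<^sup>2 / 8))"
    by (subst nn_integral_cmult) (auto intro!: mult_left_mono arm_mgf_le[OF i])
  also have "\<dots> = 1"
    by (simp add: ennreal_mult'[symmetric] exp_add[symmetric])
  finally have g: "(\<integral>\<^sup>+x. g x \<partial>\<nu> i) \<le> 1" .
  have "(\<integral>\<^sup>+\<omega>. ennreal (exp (l * reward_dev \<nu> arm rew i (Suc t) \<omega> -
      l\<^sup>2 / 8 * real (num_pulls arm i (Suc t) \<omega>))) \<partial>M) =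
      (\<integral>\<^sup>+\<omega>. X \<omega> * indicator (- {i}) (arm t \<omega>) + X \<omega> * indicator {i} (arm t \<omega>) * g (rew t \<omega>) \<partial>M)"
    using t(1) by (intro nn_integral_cong)
      (auto simp: X_def g_def num_pulls_Suc reward_dev_Suc ennreal_mult'[symmetric]
        exp_add[symmetric] algebra_simps add_divide_distrib)
  also have "\<dots> = (\<integral>\<^sup>+\<omega>. X \<omega> * indicator (- {i}) (arm t \<omega>) \<partial>M) +
      (\<integral>\<^sup>+\<omega>. X \<omega> * indicator {i} (arm t \<omega>) \<partial>M) * (\<integral>\<^sup>+x. g x \<partial>\<nu> i)"
    by (subst nn_integral_add) (auto simp: nn_integral_reward[OF t(1) i])
  also have "\<dots> \<le> (\<integral>\<^sup>+\<omega>. X \<omega> * indicator (- {i}) (arm t \<omega>) \<partial>M) +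
      (\<integral>\<^sup>+\<omega>. X \<omega> * indicator {i} (arm t \<omega>) \<partial>M) * 1"
    by (intro add_left_mono mult_left_mono g) auto
  also have "\<dots> = (\<integral>\<^sup>+\<omega>. X \<omega> * indicator (- {i}) (arm t \<omega>) + X \<omega> * indicator {i} (arm t \<omega>) \<partial>M)"
    by (subst nn_integral_add) auto
  also have "\<dots> = (\<integral>\<^sup>+\<omega>. X \<omega> \<partial>M)"
    by (intro nn_integral_cong) (auto split: split_indicator)
  also have "\<dots> \<le> 1"
    unfolding X_def using step by simp
  finally show ?case .
qed

lemma reward_dev_tail:
  assumes i: "i \<in> {1..K}" and t: "1 \<le> t" "t \<le> Suc T"
    and \<sigma>: "\<sigma> \<in> {1, -1}" and s: "1 \<le> s" and c: "0 \<le> c"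
  shows "prob {\<omega> \<in> space M. num_pulls arm i t \<omega> = s \<and> c * sqrt (real s) < \<sigma> * reward_dev \<nu> arm rew i t \<omega>}
    \<le> exp (- (2 * c\<^sup>2))"
proof -
  let ?A = "{\<omega> \<in> space M. num_pulls arm i t \<omega> = s \<and> c * sqrt (real s) < \<sigma> * reward_dev \<nu> arm rew i t \<omega>}"
  define l where "l = \<sigma> * (4 * c / sqrt (real s))"
  let ?X = "\<lambda>\<omega>. exp (l * reward_dev \<nu> arm rew i t \<omega> - l\<^sup>2 / 8 * real (num_pulls arm i t \<omega>))"
  have F: "subalgebra M (F (t - 1))" using t by (intro subalgebra_F) auto
  note [measurable] = measurable_from_subalg[OF F num_pulls_measurable_F[OF t(2)]]
    measurable_from_subalg[OF F reward_dev_measurable_F[OF t(2)]]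
  have le: "exp (2 * c\<^sup>2) \<le> ?X \<omega>" if "\<omega> \<in> ?A" for \<omega>
  proof -
    have "4 * c\<^sup>2 = 4 * c / sqrt (real s) * (c * sqrt (real s))"
      using s by (simp add: power2_eq_square)
    also have "\<dots> \<le> 4 * c / sqrt (real s) * (\<sigma> * reward_dev \<nu> arm rew i t \<omega>)"
      using that c by (intro mult_left_mono) auto
    also have "\<dots> = l * reward_dev \<nu> arm rew i t \<omega>"
      by (simp add: l_def)
    finally have "4 * c\<^sup>2 \<le> l * reward_dev \<nu> arm rew i t \<omega>" .
    moreover have "l\<^sup>2 / 8 * real (num_pulls arm i t \<omega>) = 2 * c\<^sup>2"
      using that s \<sigma> by (auto simp: l_def power_mult_distrib power_divide)
    ultimately show ?thesis by simp
  qed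
  have "ennreal (prob ?A) = (\<integral>\<^sup>+\<omega>. indicator ?A \<omega> \<partial>M)"
    by (simp add: emeasure_eq_measure)
  also have "\<dots> \<le> (\<integral>\<^sup>+\<omega>. ennreal (exp (- (2 * c\<^sup>2))) * ennreal (?X \<omega>) \<partial>M)"
    using le by (intro nn_integral_mono)
      (auto split: split_indicator simp: ennreal_mult'[symmetric] exp_add[symmetric] simp del: ennreal_1
        simp flip: ennreal_1)
  also have "\<dots> = ennreal (exp (- (2 * c\<^sup>2))) * (\<integral>\<^sup>+\<omega>. ennreal (?X \<omega>) \<partial>M)"
    by (rule nn_integral_cmult) measurable
  also have "\<dots> \<le> ennreal (exp (- (2 * c\<^sup>2))) * 1"
    by (intro mult_left_mono reward_dev_mgf_le i t) simp
  finally show ?thesis by simp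
qed

definition good_event :: "real \<Rightarrow> nat \<Rightarrow> 'a set" where
  "good_event c t = {\<omega> \<in> space M. \<forall>i\<in>{1..K}. 0 < num_pulls arm i t \<omega> \<longrightarrow>
     \<bar>reward_dev \<nu> arm rew i t \<omega>\<bar> \<le> c * sqrt (real (num_pulls arm i t \<omega>))}"

lemma good_event_sets_F:
  assumes t: "1 \<le> t" "t \<le> Suc T"
  shows "good_event c t \<in> sets (F (t - 1))"
proof -
  have F: "subalgebra M (F (t - 1))" using t by (intro subalgebra_F) auto
  then have sp: "space M = space (F (t - 1))" by (simp add: subalgebra_def)
  note [measurable] = num_pulls_measurable_F[OF t(2)] reward_dev_measurable_F[OF t(2)]
  show ?thesis
    unfolding good_event_def sp by measurable
qed

lemma prob_not_good_event_le:
  assumes t: "t \<in> {1..T}" and c: "0 \<le> c"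
  shows "prob (space M - good_event c t) \<le> 2 * real K * real T * exp (- (2 * c\<^sup>2))"
proof -
  have t': "1 \<le> t" "t \<le> Suc T" using t by auto
  let ?A = "\<lambda>(i, s, \<sigma>). {\<omega> \<in> space M. num_pulls arm i t \<omega> = s \<and>
    c * sqrt (real s) < \<sigma> * reward_dev \<nu> arm rew i t \<omega>}"
  let ?I = "{1..K} \<times> {1..T} \<times> {1, -1 :: real}"
  have F: "subalgebra M (F (t - 1))" using t by (intro subalgebra_F) auto
  note [measurable] = measurable_from_subalg[OF F num_pulls_measurable_F[OF t'(2)]]
    measurable_from_subalg[OF F reward_dev_measurable_F[OF t'(2)]]
  have sub: "space M - good_event c t \<subseteq> (\<Union>x\<in>?I. ?A x)"
  proof
    fix \<omega> assume "\<omega> \<in> space M - good_event c t"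
    then obtain i where "\<omega> \<in> space M" "i \<in> {1..K}" "0 < num_pulls arm i t \<omega>"
      "c * sqrt (real (num_pulls arm i t \<omega>)) < \<bar>reward_dev \<nu> arm rew i t \<omega>\<bar>"
      by (auto simp: good_event_def not_le)
    moreover have "num_pulls arm i t \<omega> \<le> T"
      using num_pulls_le[of arm i t \<omega>] t by auto
    moreover have "0 \<le> c * sqrt (real (num_pulls arm i t \<omega>))"
      using c by simp
    ultimately have "(i, num_pulls arm i t \<omega>, sgn (reward_dev \<nu> arm rew i t \<omega>)) \<in> ?I"
      "\<omega> \<in> ?A (i, num_pulls arm i t \<omega>, sgn (reward_dev \<nu> arm rew i t \<omega>))"
      by (auto simp: sgn_if abs_if split: if_splits)
    then show "\<omega> \<in> (\<Union>x\<in>?I. ?A x)" by blast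
  qed
  have meas: "?A x \<in> events" for x
    by (cases x) simp
  have "prob (space M - good_event c t) \<le> prob (\<Union>x\<in>?I. ?A x)"
    by (intro finite_measure_mono sub sets.finite_UN meas) auto
  also have "\<dots> \<le> (\<Sum>x\<in>?I. prob (?A x))"
    by (intro finite_measure_subadditive_finite) (use meas in auto)
  also have "\<dots> \<le> (\<Sum>x\<in>?I. exp (- (2 * c\<^sup>2)))"
  proof (rule sum_mono)
    fix x assume "x \<in> ?I"
    then obtain i s \<sigma> where x: "x = (i, s, \<sigma>)" and "i \<in> {1..K}" "\<sigma> \<in> {1, -1}" "1 \<le> s" by auto
    then show "prob (?A x) \<le> exp (- (2 * c\<^sup>2))"
      unfolding x prod.case by (intro reward_dev_tail t' c)
  qed
  also have "\<dots> = 2 * real K * real T * exp (- (2 * c\<^sup>2))"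
    by simp
  finally show ?thesis .
qed

end

subsection \<open>Regret of a single round\<close>

definition width :: "(nat \<Rightarrow> 'a \<Rightarrow> nat) \<Rightarrow> nat \<Rightarrow> nat \<Rightarrow> 'a \<Rightarrow> real" where
  "width arm i t \<omega> = sqrt (1 / real (num_pulls arm i t \<omega>))"

lemma width_nonneg: "0 \<le> width arm i t \<omega>"
  by (simp add: width_def)

lemma width_le_1: "width arm i t \<omega> \<le> 1"
  by (cases "num_pulls arm i t \<omega> = 0") (auto simp: width_def)

abbreviation (in stochastic_bandit) gap :: "nat \<Rightarrow> real" where
  "gap i \<equiv> best_mean K \<nu> - arm_mean \<nu> i"

context bandit_run
begin

lemma width_measurable_F:
  assumes "t \<le> Suc T"
  shows "width arm i t \<in> borel_measurable (F (t - 1))"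
  unfolding width_def[abs_def] using num_pulls_measurable_F[OF assms] by measurable

text \<open>The default value 1 for arms that are not undersampled never matters, because the optimal arm is
  undersampled and widths are at most 1.\<close>

definition least_width :: "real \<Rightarrow> nat \<Rightarrow> 'a \<Rightarrow> real" where
  "least_width w t \<omega> =
     (MIN i\<in>{1..K}. if gap i \<le> w * width arm i t \<omega> then width arm i t \<omega> else 1)"

lemma least_width_measurable_F:
  assumes "t \<le> Suc T"
  shows "least_width w t \<in> borel_measurable (F (t - 1))"
proof -
  note [measurable] = width_measurable_F[OF assms]
  show ?thesis
    unfolding least_width_def[abs_def] by measurable
qed

lemma least_width_le:
  assumes "i \<in> {1..K}" "gap i \<le> w * width arm i t \<omega>"
  shows "least_width w t \<omega> \<le> width arm i t \<omega>"
proof -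
  have "least_width w t \<omega> \<le> (if gap i \<le> w * width arm i t \<omega> then width arm i t \<omega> else 1)"
    unfolding least_width_def using assms(1) by (intro Min_le) auto
  then show ?thesis using assms(2) by simp
qed

lemma least_width_attained:
  assumes "0 \<le> w"
  shows "\<exists>j\<in>{1..K}. gap j \<le> w * width arm j t \<omega> \<and> least_width w t \<omega> = width arm j t \<omega>"
proof -
  obtain a where a: "a \<in> {1..K}" "gap a = 0"
    using best_mean_attained by auto
  have und: "gap a \<le> w * width arm a t \<omega>"
    using a assms width_nonneg[of arm a t \<omega>] by simp
  have "least_width w t \<omega> \<in> (\<lambda>i. if gap i \<le> w * width arm i t \<omega> then width arm i t \<omega> else 1) ` {1..K}"
    unfolding least_width_def
    by (rule Min_in) (simp_all only: finite_imageI finite_arms image_is_empty arms_ne not_False_eq_True)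
  then obtain j where j: "j \<in> {1..K}"
    "least_width w t \<omega> = (if gap j \<le> w * width arm j t \<omega> then width arm j t \<omega> else 1)" by blast
  show ?thesis
  proof (cases "gap j \<le> w * width arm j t \<omega>")
    case True
    then show ?thesis using j by auto
  next
    case False
    then have "least_width w t \<omega> = width arm a t \<omega>"
      using j least_width_le[OF a(1) und] width_le_1[of arm a t \<omega>] by simp
    then show ?thesis using a und by blast
  qed
qed

lemma least_width_bounds:
  assumes "0 \<le> w"
  shows "0 \<le> least_width w t \<omega>" "least_width w t \<omega> \<le> 1"
  using least_width_attained[OF assms, of t \<omega>] width_nonneg width_le_1 by metis+

lemma emp_mean_good_event:
  assumes "\<omega> \<in> good_event c t" "i \<in> {1..K}" "0 < num_pulls arm i t \<omega>"
  shows "\<bar>emp_mean arm rew i t \<omega> - arm_mean \<nu> i\<bar> \<le> c * width arm i t \<omega>"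
proof -
  let ?n = "real (num_pulls arm i t \<omega>)"
  have "\<bar>emp_mean arm rew i t \<omega> - arm_mean \<nu> i\<bar> = \<bar>reward_dev \<nu> arm rew i t \<omega>\<bar> / ?n"
    using emp_mean_minus_arm_mean[OF assms(3)] by simp
  also have "\<dots> \<le> c * sqrt ?n / ?n"
    using assms by (intro divide_right_mono) (auto simp: good_event_def)
  also have "\<dots> = c * width arm i t \<omega>"
    using assms(3) by (simp add: width_def real_sqrt_divide real_div_sqrt field_simps)
  finally show ?thesis .
qed

lemma arm_measurable_M:
  assumes t: "t \<in> {1..T}"
  shows "arm t \<in> measurable M (count_space UNIV)"
  by (rule measurable_from_subalg[OF subalgebra_G[OF t] arm_measurable_UNIV[OF t]])

lemma width_arm_measurable:
  assumes t: "t \<in> {1..T}"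
  shows "(\<lambda>\<omega>. width arm (arm t \<omega>) t \<omega>) \<in> borel_measurable M"
proof (rule measurable_compose_countable[OF _ arm_measurable_M[OF t]])
  show "width arm i t \<in> borel_measurable M" for i
    using t by (intro measurable_from_subalg[OF subalgebra_F width_measurable_F]) auto
qed

lemma integrable_width_arm:
  assumes t: "t \<in> {1..T}"
  shows "integrable M (\<lambda>\<omega>. width arm (arm t \<omega>) t \<omega>)"
  by (rule integrable_const_bound[where B = 1])
    (use width_arm_measurable[OF t] in \<open>auto simp: width_nonneg width_le_1\<close>)

lemma integrable_gap_arm:
  assumes t: "t \<in> {1..T}"
  shows "integrable M (\<lambda>\<omega>. gap (arm t \<omega>))"
proof (rule integrable_const_bound[where B = 1])
  show "AE \<omega> in M. norm (gap (arm t \<omega>)) \<le> 1"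
    using gap_bounds[OF arm_in[OF t]] by (intro AE_I2) (auto simp: abs_le_iff)
  show "(\<lambda>\<omega>. gap (arm t \<omega>)) \<in> borel_measurable M"
    by (rule measurable_compose[OF arm_measurable_M[OF t]]) simp
qed

lemma expectation_gap_arm_le_1:
  assumes t: "t \<in> {1..T}"
  shows "expectation (\<lambda>\<omega>. gap (arm t \<omega>)) \<le> 1"
  by (rule integral_le_const[OF integrable_gap_arm[OF t]])
    (use gap_bounds(2)[OF arm_in[OF t]] in auto)

lemma expectation_sum_width_le:
  "(\<Sum>t=1..T. expectation (\<lambda>\<omega>. width arm (arm t \<omega>) t \<omega>))
    \<le> sqrt (2 * real K * ln (1 + real T / real K) * real T)"
proof -
  have "(\<Sum>t=1..T. expectation (\<lambda>\<omega>. width arm (arm t \<omega>) t \<omega>)) =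
      expectation (\<lambda>\<omega>. \<Sum>t=1..T. width arm (arm t \<omega>) t \<omega>)"
    by (rule Bochner_Integration.integral_sum[symmetric]) (rule integrable_width_arm)
  also have "\<dots> \<le> sqrt (2 * real K * ln (1 + real T / real K) * real T)"
  proof (rule integral_le_const)
    show "integrable M (\<lambda>\<omega>. \<Sum>t=1..T. width arm (arm t \<omega>) t \<omega>)"
      by (rule Bochner_Integration.integrable_sum) (rule integrable_width_arm)
    show "AE \<omega> in M. (\<Sum>t=1..T. width arm (arm t \<omega>) t \<omega>)
        \<le> sqrt (2 * real K * ln (1 + real T / real K) * real T)"
      unfolding width_def by (intro AE_I2 sum_sqrt_inverse_num_pulls_le arms_nonempty arm_in)
  qed
  finally show ?thesis .
qed

end

context randucb
begin

lemma num_pulls_pos: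
  assumes t: "t \<in> {1..T}" "K < t" and \<omega>: "\<omega> \<in> space M" and i: "i \<in> {1..K}"
  shows "0 < num_pulls arm i t \<omega>"
proof -
  have new: "arm u \<omega> \<noteq> arm v \<omega>" if "u \<in> {1..K}" "v \<in> {1..K}" "u < v" for u v
  proof -
    have "num_pulls arm (arm v \<omega>) v \<omega> = 0"
      using that t \<omega> by (intro initial_pulls) auto
    then show ?thesis
      using that by (auto simp: num_pulls_def)
  qed
  have "inj_on (\<lambda>u. arm u \<omega>) {1..K}"
    using new by (intro inj_onI) (metis linorder_neqE_nat)
  moreover have "(\<lambda>u. arm u \<omega>) ` {1..K} \<subseteq> {1..K}"
    using arm_in[of _ \<omega>] t \<omega> by fastforce
  ultimately have "(\<lambda>u. arm u \<omega>) ` {1..K} = {1..K}"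
    by (intro endo_inj_surj) auto
  then obtain u where "u \<in> {1..K}" "arm u \<omega> = i"
    using i by (metis (no_types, lifting) imageE)
  then have "u \<in> {u \<in> {1..<t}. arm u \<omega> = i}"
    using t by auto
  then show ?thesis
    unfolding num_pulls_def by (auto simp: card_gt_0_iff)
qed

lemma chosen_index_ge:
  assumes t: "t \<in> {1..T}" "K < t" and \<omega>: "\<omega> \<in> space M" and i: "i \<in> {1..K}"
  shows "emp_mean arm rew i t \<omega> + Zs t \<omega> * width arm i t \<omega>
    \<le> emp_mean arm rew (arm t \<omega>) t \<omega> + Zs t \<omega> * width arm (arm t \<omega>) t \<omega>"
  using argmax_pulls[OF t \<omega>] i by (auto simp: is_arg_max_def width_def not_less)

lemma gap_arm_le:
  assumes t: "t \<in> {1..T}" "K < t" and \<omega>: "\<omega> \<in> good_event c1 t"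
    and Z: "\<bar>Zs t \<omega>\<bar> \<le> c2" and c: "0 \<le> c1 + c2"
  shows "gap (arm t \<omega>) \<le> (c1 + c2) * (2 * least_width (c1 + c2) t \<omega> + width arm (arm t \<omega>) t \<omega>)"
proof -
  have sp: "\<omega> \<in> space M" using \<omega> by (simp add: good_event_def)
  let ?f = "\<lambda>i. emp_mean arm rew i t \<omega> + Zs t \<omega> * width arm i t \<omega>"
  have dev: "\<bar>?f i - arm_mean \<nu> i\<bar> \<le> (c1 + c2) * width arm i t \<omega>" if i: "i \<in> {1..K}" for i
  proof -
    have "\<bar>emp_mean arm rew i t \<omega> - arm_mean \<nu> i\<bar> \<le> c1 * width arm i t \<omega>"
      by (intro emp_mean_good_event \<omega> i num_pulls_pos t sp)
    moreover have "\<bar>Zs t \<omega> * width arm i t \<omega>\<bar> \<le> c2 * width arm i t \<omega>"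
      unfolding abs_mult using Z width_nonneg[of arm i t \<omega>] by (simp add: mult_right_mono)
    ultimately show ?thesis by (simp add: distrib_right)
  qed
  obtain j where j: "j \<in> {1..K}" "gap j \<le> (c1 + c2) * width arm j t \<omega>"
    "least_width (c1 + c2) t \<omega> = width arm j t \<omega>"
    using least_width_attained[OF c] by blast
  show ?thesis
    using dev[OF j(1)] dev[OF arm_in[OF t(1) sp]] chosen_index_ge[OF t sp j(1)] j(2)
    unfolding j(3) by (simp add: distrib_left)
qed

lemma least_width_le_width_arm:
  assumes t: "t \<in> {1..T}" "K < t" and \<omega>: "\<omega> \<in> good_event c1 t"
    and Z: "c1 < Zs t \<omega>" "Zs t \<omega> \<le> c2"
  shows "least_width (c1 + c2) t \<omega> \<le> width arm (arm t \<omega>) t \<omega>"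
proof (rule least_width_le)
  have sp: "\<omega> \<in> space M" using \<omega> by (simp add: good_event_def)
  let ?i = "arm t \<omega>"
  show i: "?i \<in> {1..K}" by (rule arm_in[OF t(1) sp])
  obtain a where a: "a \<in> {1..K}" "best_mean K \<nu> = arm_mean \<nu> a"
    using best_mean_attained by auto
  have "0 < width arm a t \<omega>"
    using num_pulls_pos[OF t sp a(1)] by (simp add: width_def)
  then have "c1 * width arm a t \<omega> < Zs t \<omega> * width arm a t \<omega>"
    using Z by simp
  moreover have "Zs t \<omega> * width arm ?i t \<omega> \<le> c2 * width arm ?i t \<omega>"
    using Z by (intro mult_right_mono width_nonneg)
  moreover have "\<bar>emp_mean arm rew i t \<omega> - arm_mean \<nu> i\<bar> \<le> c1 * width arm i t \<omega>" if "i \<in> {1..K}" for i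
    by (intro emp_mean_good_event \<omega> that num_pulls_pos t sp)
  note this[OF a(1)] this[OF i]
  ultimately show "gap ?i \<le> (c1 + c2) * width arm ?i t \<omega>"
    using chosen_index_ge[OF t sp a(1)] a(2) by (simp add: distrib_right)
qed

lemma Zs_measurable_M: "t \<in> {1..T} \<Longrightarrow> Zs t \<in> borel_measurable M"
  by (rule measurable_from_subalg[OF subalgebra_G Zs_measurable])

lemma prob_Zs:
  assumes t: "t \<in> {1..T}" and B: "B \<in> sets borel"
  shows "prob {\<omega> \<in> space M. Zs t \<omega> \<in> B} = \<P>(x in N. Z x \<in> B)"
proof -
  have "prob {\<omega> \<in> space M. Zs t \<omega> \<in> B} = measure (distr M borel (Zs t)) B"
    using B Zs_measurable_M[OF t] by (subst measure_distr) (auto simp: vimage_def Int_def conj_commute)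
  also have "\<dots> = \<P>(x in N. Z x \<in> B)"
    unfolding Zs_distr[OF t]
    using B Z_measurable by (subst measure_distr) (auto simp: vimage_def Int_def conj_commute)
  finally show ?thesis .
qed

lemma indep_past_Zs:
  assumes t: "t \<in> {1..T}" and X: "X \<in> borel_measurable (F (t - 1))"
  shows "indep_var borel X borel (Zs t)"
proof -
  have F: "subalgebra M (F (t - 1))" using t by (intro subalgebra_F) auto
  then have sp: "space (F (t - 1)) = space M" by (simp add: subalgebra_def)
  have "sigma_sets (space M) {X -` A \<inter> space M |A. A \<in> sets borel} \<subseteq> sets (F (t - 1))"
    unfolding sp[symmetric] by (rule sets.sigma_sets_subset) (use measurable_sets[OF X] in blast)
  moreover have "sigma_sets (space M) {Zs t -` A \<inter> space M |A. A \<in> sets borel} =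
      sets (vimage_algebra (space M) (Zs t) borel)"
    unfolding vimage_algebra_def by (subst sets_measure_of) auto
  ultimately have "indep_set (sigma_sets (space M) {X -` A \<inter> space M |A. A \<in> sets borel})
      (sigma_sets (space M) {Zs t -` A \<inter> space M |A. A \<in> sets borel})"
    using Zs_indep[OF t] unfolding indep_set_def
    by (elim indep_sets_mono_sets) (auto split: bool.split)
  then show ?thesis
    unfolding indep_var_eq
    using measurable_from_subalg[OF F X] Zs_measurable_M[OF t] by simp
qed

lemma expectation_past_times_Zs:
  assumes t: "t \<in> {1..T}" and X: "X \<in> borel_measurable (F (t - 1))"
    and int: "integrable M X" and B [measurable]: "B \<in> sets borel"
  shows "expectation (\<lambda>\<omega>. X \<omega> * indicator B (Zs t \<omega>)) = expectation X * \<P>(x in N. Z x \<in> B)"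
proof -
  note [measurable] = Zs_measurable_M[OF t]
  let ?I = "\<lambda>\<omega>. indicator B (Zs t \<omega>) :: real"
  have "indep_var borel ((\<lambda>x. x) \<circ> X) borel (indicator B \<circ> Zs t :: 'a \<Rightarrow> real)"
    by (rule indep_var_compose[OF indep_past_Zs[OF t X]]) measurable
  then have "expectation (\<lambda>\<omega>. X \<omega> * ?I \<omega>) = expectation X * expectation ?I"
    by (intro indep_var_lebesgue_integral int integrable_const_bound[where B = 1])
      (auto simp: comp_def)
  also have "expectation ?I = expectation (indicator {\<omega> \<in> space M. Zs t \<omega> \<in> B})"
    by (intro Bochner_Integration.integral_cong) (auto split: split_indicator)
  also have "\<dots> = \<P>(x in N. Z x \<in> B)"
    using prob_Zs[OF t B] by simp
  finally show ?thesis .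
qed

lemma prob_Z_interval_ge:
  "\<P>(x in N. Z x > c1) - \<P>(x in N. \<bar>Z x\<bar> > c2) \<le> \<P>(x in N. Z x \<in> {c1<..c2})"
proof -
  note [measurable] = Z_measurable
  have "\<P>(x in N. Z x > c1) \<le> measure N ({x \<in> space N. Z x \<in> {c1<..c2}} \<union> {x \<in> space N. \<bar>Z x\<bar> > c2})"
    by (intro Z.finite_measure_mono) auto
  also have "\<dots> \<le> \<P>(x in N. Z x \<in> {c1<..c2}) + \<P>(x in N. \<bar>Z x\<bar> > c2)"
    by (intro measure_Un_le) auto
  finally show ?thesis by simp
qed

lemma expectation_least_width_le:
  assumes t: "t \<in> {1..T}" "K < t" and c: "0 \<le> c1 + c2"
    and p: "\<P>(x in N. \<bar>Z x\<bar> > c2) < \<P>(x in N. Z x > c1)"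
  shows "expectation (\<lambda>\<omega>. indicator (good_event c1 t) \<omega> * least_width (c1 + c2) t \<omega>)
    \<le> expectation (\<lambda>\<omega>. width arm (arm t \<omega>) t \<omega>) /
      (\<P>(x in N. Z x > c1) - \<P>(x in N. \<bar>Z x\<bar> > c2))"
proof -
  define X where "X = (\<lambda>\<omega>. indicator (good_event c1 t) \<omega> * least_width (c1 + c2) t \<omega>)"
  let ?p = "\<P>(x in N. Z x > c1) - \<P>(x in N. \<bar>Z x\<bar> > c2)"
  let ?I = "\<lambda>\<omega>. indicator {c1<..c2} (Zs t \<omega>) :: real"
  have t': "1 \<le> t" "t \<le> Suc T" using t by auto
  have F: "subalgebra M (F (t - 1))" using t by (intro subalgebra_F) auto
  note [measurable] = Zs_measurable_M[OF t(1)]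
  have X_F: "X \<in> borel_measurable (F (t - 1))"
    unfolding X_def using good_event_sets_F[OF t'] least_width_measurable_F[OF t'(2)]
    by measurable
  have X_M [measurable]: "X \<in> borel_measurable M"
    by (rule measurable_from_subalg[OF F X_F])
  have X: "0 \<le> X \<omega>" "X \<omega> \<le> 1" for \<omega>
    using least_width_bounds[OF c] by (auto simp: X_def split: split_indicator)
  have int: "integrable M X"
    by (rule integrable_const_bound[where B = 1]) (use X in auto)
  have "expectation X * ?p \<le> expectation X * \<P>(x in N. Z x \<in> {c1<..c2})"
    using X by (intro mult_left_mono prob_Z_interval_ge integral_nonneg_AE) auto
  also have "\<dots> = expectation (\<lambda>\<omega>. X \<omega> * ?I \<omega>)"
    by (rule expectation_past_times_Zs[OF t(1) X_F int, symmetric]) simp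
  also have "\<dots> \<le> expectation (\<lambda>\<omega>. width arm (arm t \<omega>) t \<omega>)"
  proof (rule integral_mono)
    show "integrable M (\<lambda>\<omega>. X \<omega> * ?I \<omega>)"
      by (rule integrable_const_bound[where B = 1]) (use X in \<open>auto split: split_indicator\<close>)
    show "X \<omega> * ?I \<omega> \<le> width arm (arm t \<omega>) t \<omega>" for \<omega>
      using least_width_le_width_arm[OF t, of \<omega> c1 c2]
      by (auto simp: X_def width_nonneg split: split_indicator)
  qed (rule integrable_width_arm[OF t(1)])
  finally show ?thesis
    using p by (simp add: X_def field_simps)
qed

lemma expectation_gap_arm_le:
  assumes t: "t \<in> {1..T}" "K < t" and c: "0 \<le> c1 + c2"
    and p: "\<P>(x in N. \<bar>Z x\<bar> > c2) < \<P>(x in N. Z x > c1)"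
  shows "expectation (\<lambda>\<omega>. gap (arm t \<omega>)) \<le>
    prob (space M - good_event c1 t) + \<P>(x in N. \<bar>Z x\<bar> > c2) +
    (c1 + c2) * (1 + 2 / (\<P>(x in N. Z x > c1) - \<P>(x in N. \<bar>Z x\<bar> > c2))) *
      expectation (\<lambda>\<omega>. width arm (arm t \<omega>) t \<omega>)"
proof -
  define w where "w = c1 + c2"
  define p where "p = \<P>(x in N. Z x > c1) - \<P>(x in N. \<bar>Z x\<bar> > c2)"
  define W where "W = (\<lambda>\<omega>. width arm (arm t \<omega>) t \<omega>)"
  define X where "X = (\<lambda>\<omega>. indicator (good_event c1 t) \<omega> * least_width w t \<omega>)"
  let ?bad = "space M - good_event c1 t" and ?big = "{\<omega> \<in> space M. Zs t \<omega> \<in> {z. c2 < \<bar>z\<bar>}}"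
  have t': "1 \<le> t" "t \<le> Suc T" using t by auto
  have F: "subalgebra M (F (t - 1))" using t by (intro subalgebra_F) auto
  have w: "0 \<le> w" using c by (simp add: w_def)
  note [measurable] = Zs_measurable_M[OF t(1)]
  have good [measurable]: "good_event c1 t \<in> events"
    using good_event_sets_F[OF t'] F by (auto simp: subalgebra_def)
  have [measurable]: "least_width w t \<in> borel_measurable M"
    by (rule measurable_from_subalg[OF F least_width_measurable_F[OF t'(2)]])
  have int_X: "integrable M X"
    unfolding X_def using least_width_bounds[OF w, of t]
    by (intro integrable_const_bound[where B = 1]) (auto split: split_indicator)
  have int_W: "integrable M W"
    unfolding W_def by (rule integrable_width_arm[OF t(1)])
  have int_ind: "integrable M (indicator A :: 'a \<Rightarrow> real)" if "A \<in> events" for A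
    using that by (intro integrable_const_bound[where B = 1]) (auto split: split_indicator)
  have int_bad: "integrable M (indicator ?bad :: 'a \<Rightarrow> real)"
    and int_big: "integrable M (indicator ?big :: 'a \<Rightarrow> real)"
    by (rule int_ind, measurable)+
  have "expectation (\<lambda>\<omega>. gap (arm t \<omega>)) \<le>
      expectation (\<lambda>\<omega>. indicator ?bad \<omega> + indicator ?big \<omega> + (w * 2 * X \<omega> + w * W \<omega>))"
  proof (rule integral_mono[OF integrable_gap_arm[OF t(1)]])
    show "integrable M (\<lambda>\<omega>. indicator ?bad \<omega> + indicator ?big \<omega> + (w * 2 * X \<omega> + w * W \<omega>))"
      by (intro Bochner_Integration.integrable_add integrable_mult_right int_X int_W int_bad int_big)
    fix \<omega> assume \<omega>: "\<omega> \<in> space M"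
    have nonneg: "0 \<le> w * 2 * X \<omega>" "0 \<le> w * W \<omega>"
      using w least_width_bounds[OF w, of t \<omega>] by (auto simp: X_def W_def width_nonneg)
    show "gap (arm t \<omega>) \<le> indicator ?bad \<omega> + indicator ?big \<omega> + (w * 2 * X \<omega> + w * W \<omega>)"
    proof (cases "\<omega> \<in> good_event c1 t \<and> \<bar>Zs t \<omega>\<bar> \<le> c2")
      case True
      then have "gap (arm t \<omega>) \<le> w * 2 * X \<omega> + w * W \<omega>"
        using gap_arm_le[OF t, of \<omega> c1 c2] c by (simp add: w_def X_def W_def algebra_simps)
      then show ?thesis by (simp add: add_increasing)
    next
      case False
      then have "1 \<le> (indicator ?bad \<omega> + indicator ?big \<omega> :: real)"
        using \<omega> by (auto split: split_indicator)
      then show ?thesis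
        using nonneg gap_bounds(2)[OF arm_in[OF t(1) \<omega>]] by linarith
    qed
  qed
  also have "\<dots> = prob ?bad + prob ?big + (w * 2 * expectation X + w * expectation W)"
    using int_X int_W int_bad int_big by simp
  also have "\<dots> \<le> prob ?bad + prob ?big + (w * 2 * (expectation W / p) + w * expectation W)"
    using expectation_least_width_le[OF t c assms(4)] c
    by (intro add_mono mult_left_mono order_refl) (auto simp: X_def W_def w_def p_def)
  also have "prob ?big = \<P>(x in N. \<bar>Z x\<bar> > c2)"
    by (subst prob_Zs[OF t(1)]) auto
  finally show ?thesis
    by (simp add: p_def W_def w_def algebra_simps)
qed

lemma regret_le:
  assumes T: "1 \<le> T"
    and c1: "c1 = 1 + sqrt (ln (real K * (real T)\<^sup>2))" and c3: "c3 = 2 * real K * ln (1 + real T / real K)"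
    and c2: "c1 < c2"
    and p: "\<P>(x in N. \<bar>Z x\<bar> > c2) < \<P>(x in N. Z x > c1)"
  shows "regret M K \<nu> arm T
    \<le> (c1 + c2) * (1 + 2 / (\<P>(x in N. Z x > c1) - \<P>(x in N. \<bar>Z x\<bar> > c2))) * sqrt (c3 * real T)
      + real T * \<P>(x in N. \<bar>Z x\<bar> > c2) + real K + 1"
proof -
  define L where "L = ln (real K * (real T)\<^sup>2)"
  have KT: "1 \<le> real K * (real T)\<^sup>2"
    using T arms_nonempty by (metis mult_mono' mult_1 of_nat_1 of_nat_mono one_le_power zero_le_one)
  have L: "0 \<le> L" using KT by (simp add: L_def)
  have c1_pos: "0 \<le> c1" using L by (simp add: c1 L_def)
  define C where "C = (c1 + c2) * (1 + 2 / (\<P>(x in N. Z x > c1) - \<P>(x in N. \<bar>Z x\<bar> > c2)))"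
  have C: "0 \<le> C"
    using c1_pos c2 p unfolding C_def by (intro mult_nonneg_nonneg add_nonneg_nonneg divide_nonneg_pos) auto
  have bad: "prob (space M - good_event c1 t) \<le> 1 / real T" if t: "t \<in> {1..T}" for t
  proof -
    have "1 + L \<le> c1\<^sup>2"
      using L by (simp add: c1 L_def power2_eq_square algebra_simps)
    then have "exp (- (2 * c1\<^sup>2)) \<le> exp (- 1 - L)"
      using L by simp
    also have "\<dots> = exp (- 1) / (real K * (real T)\<^sup>2)"
      using KT by (simp add: exp_diff L_def)
    also have "\<dots> \<le> (1 / 2) / (real K * (real T)\<^sup>2)"
      using exp_ge_add_one_self[of 1] KT
      by (intro divide_right_mono) (auto simp: exp_minus field_simps)
    finally have e: "exp (- (2 * c1\<^sup>2)) \<le> (1 / 2) / (real K * (real T)\<^sup>2)" .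
    have "prob (space M - good_event c1 t) \<le> 2 * real K * real T * exp (- (2 * c1\<^sup>2))"
      by (rule prob_not_good_event_le[OF t c1_pos])
    also have "\<dots> \<le> 2 * real K * real T * ((1 / 2) / (real K * (real T)\<^sup>2))"
      by (intro mult_left_mono e) simp
    also have "\<dots> = 1 / real T"
      using T arms_nonempty by (simp add: power2_eq_square)
    finally show ?thesis .
  qed
  have "expectation (\<lambda>\<omega>. gap (arm t \<omega>)) \<le> (if t \<le> K then 1 else 0) +
      (1 / real T + \<P>(x in N. \<bar>Z x\<bar> > c2) + C * expectation (\<lambda>\<omega>. width arm (arm t \<omega>) t \<omega>))"
    if t: "t \<in> {1..T}" for t
  proof (cases "t \<le> K")
    case True
    have "0 \<le> C * expectation (\<lambda>\<omega>. width arm (arm t \<omega>) t \<omega>)"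
      using C by (intro mult_nonneg_nonneg integral_nonneg_AE) (auto simp: width_nonneg)
    then have "0 \<le> 1 / real T + \<P>(x in N. \<bar>Z x\<bar> > c2) + C * expectation (\<lambda>\<omega>. width arm (arm t \<omega>) t \<omega>)"
      by simp
    then show ?thesis
      using True expectation_gap_arm_le_1[OF t] by simp
  next
    case False
    then show ?thesis
      using expectation_gap_arm_le[OF t, of c1 c2] bad[OF t] c1_pos c2 p unfolding C_def by simp
  qed
  then have "regret M K \<nu> arm T \<le> (\<Sum>t=1..T. (if t \<le> K then 1 else 0) +
      (1 / real T + \<P>(x in N. \<bar>Z x\<bar> > c2) + C * expectation (\<lambda>\<omega>. width arm (arm t \<omega>) t \<omega>)))"
    unfolding regret_def by (rule sum_mono)
  also have "\<dots> = (\<Sum>t=1..T. if t \<le> K then 1 else 0) + 1 + real T * \<P>(x in N. \<bar>Z x\<bar> > c2) +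
      C * (\<Sum>t=1..T. expectation (\<lambda>\<omega>. width arm (arm t \<omega>) t \<omega>))"
    using T by (simp add: sum.distrib sum_distrib_left distrib_left)
  finally have "regret M K \<nu> arm T \<le> (\<Sum>t=1..T. if t \<le> K then 1 else 0) + 1 +
    real T * \<P>(x in N. \<bar>Z x\<bar> > c2) + C * (\<Sum>t=1..T. expectation (\<lambda>\<omega>. width arm (arm t \<omega>) t \<omega>))" .
  moreover have "(\<Sum>t=1..T. if t \<le> K then 1 else 0 :: real) \<le> real K"
  proof -
    have "(\<Sum>t=1..T. if t \<le> K then 1 else 0 :: real) = real (card ({1..T} \<inter> {t. t \<le> K}))"
      by (simp add: sum.If_cases)
    also have "card ({1..T} \<inter> {t. t \<le> K}) \<le> card {1..K}"
      by (intro card_mono) auto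
    finally show ?thesis by simp
  qed
  moreover have "C * (\<Sum>t=1..T. expectation (\<lambda>\<omega>. width arm (arm t \<omega>) t \<omega>)) \<le> C * sqrt (c3 * real T)"
    unfolding c3 by (intro mult_left_mono expectation_sum_width_le C)
  ultimately show ?thesis
    unfolding C_def by linarith
qed

end

theorem theorem1:
  fixes K T :: nat and \<nu> :: "nat \<Rightarrow> real measure"
    and M :: "'a measure" and F G :: "nat \<Rightarrow> 'a measure"
    and arm :: "nat \<Rightarrow> 'a \<Rightarrow> nat" and rew :: "nat \<Rightarrow> 'a \<Rightarrow> real"
    and N :: "'b measure" and Z :: "'b \<Rightarrow> real" and Zs :: "nat \<Rightarrow> 'a \<Rightarrow> real"
    and c1 c2 c3 :: real
  assumes "randucb K \<nu> M T F G arm rew N Z Zs"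
    and "1 \<le> T"
    and "c1 = 1 + sqrt (ln (real K * (real T)\<^sup>2))"
    and "c3 = 2 * real K * ln (1 + real T / real K)"
    and "c1 < c2"
    and "\<P>(x in N. \<bar>Z x\<bar> > c2) < \<P>(x in N. Z x > c1)"
  shows "regret M K \<nu> arm T
    \<le> (c1 + c2) * (1 + 2 / (\<P>(x in N. Z x > c1) - \<P>(x in N. \<bar>Z x\<bar> > c2))) * sqrt (c3 * real T)
      + real T * \<P>(x in N. \<bar>Z x\<bar> > c2) + real K + 1"
  using randucb.regret_le[OF assms(1)] assms by blast

end
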